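(* Let $n\ge1$ and $B\in\mathrm{M}_n(E_1)$. Let \[p_{B^2}(x)=\det(xI_n-B^2)=\gamma_0+\gamma_1x+\cdots+\gamma_{n-1}x^{n-1}+\gamma_nx^n\in E_0[x]\] be the characteristic polynomial of $B^2\in\mathrm{M}_n(E_0)$ (so $\gamma_n=1$). Define $\delta_0,\dots,\delta_n\in E_1$ by $\delta_n=0$ and, descending for $k=n-1,\dots,0$, \[\delta_k=\Big\{-\frac1{n-k}\sum_{i=1}^{n-k}\delta_{k+i}\,\mathrm{tr}(B^{2i})\Big\}+\Big\{-\frac1{n-k}\sum_{\substack{r+s\le n-k-1\\ r,s\ge0}}\gamma_{k+r+s+1}\,\mathrm{tr}(B^{2r+2s+1})\Big\}.\] Then \[\delta_0I_n+\gamma_1B+\delta_1B^2+2\gamma_2B^3+\delta_2B^4+\cdots+(n-1)\gamma_{n-1}B^{2n-3}+\delta_{n-1}B^{2n-2}+nB^{2n-1}=0,\] i.e. $\delta_0I_n+\sum_{k=1}^n\{k\gamma_kB^{2k-1}+\delta_kB^{2k}\}=0$; this is an identity of degree $2n-1$ in $B$ whose leading coefficient $n$ is invertible.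
   Context: $K$ is a field of characteristic zero. $E$ is the infinite-dimensional Grassmann (exterior) algebra over $K$, generated by countably many indeterminates $v_1,v_2,\dots$ subject to $v_iv_j+v_jv_i=0$ for all $i,j$. $E=E_0\oplus E_1$ is its natural $\mathbb{Z}_2$-grading: $E_0$ (resp. $E_1$) is the $K$-span of products of an even (resp. odd) number of generators; $E_0$ is commutative and central in $E$. $\mathrm{M}_n(R)$ denotes the $n\times n$ matrices over $R$, $I_n$ the identity matrix, and $\mathrm{tr}$ the sum of diagonal entries. For $B\in\mathrm{M}_n(E_1)$ one has $B^2\in\mathrm{M}_n(E_0)$. *)

theory Defs
  imports Main "HOL-Library.Function_Algebras" "HOL-Combinatorics.Permutations"
begin

text \<open>An element of E is represented by its coordinates with respect to the basis
  v_A = v_a1 v_a2 ... v_ak (a1 < a2 < ... < ak), indexed by finite sets A of natural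
  numbers (generator v_i has index i).  Addition, subtraction, zero are pointwise
  (HOL-Library.Function_Algebras); the Grassmann product is gmul below.  The pointwise
  product of functions is NOT used.\<close>

type_synonym 'k grass = "nat set \<Rightarrow> 'k"

text \<open>v_A v_B = (-1)^(number of pairs a in A, b in B with b < a) v_(A union B) for disjoint A, B.\<close>
definition inv_count :: "nat set \<Rightarrow> nat set \<Rightarrow> nat" where
  "inv_count A B = card {(a, b). a \<in> A \<and> b \<in> B \<and> b < a}"

definition gmul :: "'k::comm_ring_1 grass \<Rightarrow> 'k grass \<Rightarrow> 'k grass" where
  "gmul f g = (\<lambda>S. if finite S
      then (\<Sum>A\<in>Pow S. (-1) ^ inv_count A (S - A) * f A * g (S - A)) else 0)"

definition gone :: "'k::comm_ring_1 grass" where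
  "gone = (\<lambda>S. if S = {} then 1 else 0)"

definition gen :: "nat \<Rightarrow> 'k::comm_ring_1 grass" where
  "gen i = (\<lambda>S. if S = {i} then 1 else 0)"

definition gscale :: "'k::comm_ring_1 \<Rightarrow> 'k grass \<Rightarrow> 'k grass" where
  "gscale c f = (\<lambda>S. c * f S)"

definition grass_elem :: "'k::zero grass \<Rightarrow> bool" where
  "grass_elem f \<longleftrightarrow> finite {S. f S \<noteq> 0} \<and> (\<forall>S. f S \<noteq> 0 \<longrightarrow> finite S)"

definition grass_odd :: "'k::zero grass \<Rightarrow> bool" where
  "grass_odd f \<longleftrightarrow> grass_elem f \<and> (\<forall>S. f S \<noteq> 0 \<longrightarrow> odd (card S))"

section \<open>n x n matrices over E (entries indexed by i, j < n)\<close>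

type_synonym 'k gmat = "nat \<Rightarrow> nat \<Rightarrow> 'k grass"

definition gmat_mult :: "nat \<Rightarrow> 'k::comm_ring_1 gmat \<Rightarrow> 'k gmat \<Rightarrow> 'k gmat" where
  "gmat_mult n A B = (\<lambda>i j. \<Sum>l<n. gmul (A i l) (B l j))"

definition gmat_id :: "'k::comm_ring_1 gmat" where
  "gmat_id = (\<lambda>i j. if i = j then gone else 0)"

primrec gmat_pow :: "nat \<Rightarrow> 'k::comm_ring_1 gmat \<Rightarrow> nat \<Rightarrow> 'k gmat" where
  "gmat_pow n A 0 = gmat_id"
| "gmat_pow n A (Suc k) = gmat_mult n A (gmat_pow n A k)"

definition gmat_trace :: "nat \<Rightarrow> 'k::comm_ring_1 gmat \<Rightarrow> 'k grass" where
  "gmat_trace n A = (\<Sum>i<n. A i i)"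

text \<open>A polynomial is its coefficient sequence (coefficient of x^k at k).\<close>
type_synonym 'k gpoly = "nat \<Rightarrow> 'k grass"

definition gpoly_mult :: "'k::comm_ring_1 gpoly \<Rightarrow> 'k gpoly \<Rightarrow> 'k gpoly" where
  "gpoly_mult p q = (\<lambda>k. \<Sum>i\<le>k. gmul (p i) (q (k - i)))"

definition gpoly_one :: "'k::comm_ring_1 gpoly" where
  "gpoly_one = (\<lambda>k. if k = 0 then gone else 0)"

text \<open>Leibniz determinant of an n x n matrix of polynomials (the product is taken in
  row order; for matrices over the commutative subalgebra E_0 the order is irrelevant)\<close>
definition gpoly_det :: "nat \<Rightarrow> (nat \<Rightarrow> nat \<Rightarrow> 'k::comm_ring_1 gpoly) \<Rightarrow> 'k gpoly" where
  "gpoly_det n M = (\<Sum>\<sigma> | \<sigma> permutes {..<n}.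
      (\<lambda>k. gscale (of_int (sign \<sigma>))
             (foldr (\<lambda>i acc. gpoly_mult (M i (\<sigma> i)) acc) [0..<n] gpoly_one k)))"

definition charpoly_coeff :: "nat \<Rightarrow> 'k::comm_ring_1 gmat \<Rightarrow> nat \<Rightarrow> 'k grass" where
  "charpoly_coeff n C = gpoly_det n (\<lambda>i j k.
      (if k = 1 \<and> i = j then gone else 0) - (if k = 0 then C i j else 0))"

end

theory Submission
  imports Defs "Jordan_Normal_Form.Char_Poly" "HOL-Computational_Algebra.Polynomial_FPS"
begin

text \<open>Adjoin a further odd generator \<open>\<theta>\<close>. Then \<open>C = B\<^sup>2 + \<theta> B\<close> has entries in a commutative
  ring, and since \<open>\<theta>\<close> anticommutes with the entries of \<open>B\<close>, \<open>(\<theta> B)\<^sup>2 = 0\<close> and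
  \<open>C\<^sup>k = B\<^sup>2\<^sup>k + k \<theta> B\<^sup>2\<^sup>k\<^sup>-\<^sup>1\<close>. The characteristic polynomial of \<open>C\<close> has coefficients
  \<open>\<gamma>\<^sub>k + \<theta> \<epsilon>\<^sub>k\<close>. The \<open>\<theta>\<close>-part of the Cayley-Hamilton identity for \<open>C\<close> is the claim with \<open>\<epsilon>\<close> in place
  of \<open>\<delta>\<close>, and the \<open>\<theta>\<close>-part of Newton's identities for \<open>C\<close> is the recursion defining \<open>\<delta>\<close>, so
  \<open>\<delta> = \<epsilon>\<close>. The ring of all \<open>a + \<theta> b\<close> with \<open>a \<in> E\<^sub>0\<close>, \<open>b \<in> E\<^sub>1\<close> is \<open>E\<close> itself with products of
  two odd elements set to zero.\<close>

section \<open>Cayley-Hamilton and Newton's identities over commutative rings\<close>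

lemma derivation_prod:
  fixes D :: "'a::comm_ring_1 \<Rightarrow> 'a"
  assumes mult: "\<And>x y. D (x * y) = D x * y + x * D y" and "finite I"
  shows "D (prod f I) = (\<Sum>a\<in>I. D (f a) * prod f (I - {a}))"
  using \<open>finite I\<close>
proof (induction I rule: finite_induct)
  case empty
  \<comment> \<open>The product rule at \<open>1 * 1\<close> reads \<open>D 1 = D 1 + D 1\<close>,
    so \<open>D 1 = 0\<close>.\<close>
  show ?case using mult[of 1 1] by simp
next
  case (insert x I)
  have "f x * prod f (I - {a}) = prod f (insert x I - {a})" if "a \<in> I" for a
  proof -
    have "insert x I - {a} = insert x (I - {a})"
      using insert.hyps that by auto
    then show ?thesis
      using insert.hyps by simp
  qed
  then have "f x * (\<Sum>a\<in>I. D (f a) * prod f (I - {a})) = (\<Sum>a\<in>I. D (f a) * prod f (insert x I - {a}))"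
    unfolding sum_distrib_left by (intro sum.cong) (auto simp: mult.left_commute[of "f x"])
  then show ?case
    using insert by (simp add: mult)
qed

text \<open>Jacobi's formula for an arbitrary derivation. Applying \<open>D\<close> to the Leibniz
  sum gives the sum over \<open>i\<close> of the determinants with row \<open>i\<close>
  differentiated, and Laplace expansion along that row produces cofactors of \<open>A\<close>
  itself.\<close>

lemma derivation_det:
  fixes D :: "'a::comm_ring_1 \<Rightarrow> 'a"
  assumes add: "\<And>x y. D (x + y) = D x + D y"
    and mult: "\<And>x y. D (x * y) = D x * y + x * D y"
    and A: "A \<in> carrier_mat n n"
  shows "D (det A) = (\<Sum>i<n. \<Sum>j<n. D (A $$ (i, j)) * cofactor A i j)"
proof -
  have D0: "D 0 = 0" using add[of 0 0] by simp
  have D1: "D 1 = 0" using mult[of 1 1] by simp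
  have Dm: "D (- x) = - D x" for x using add[of x "- x"] D0 by (simp add: add_eq_0_iff)
  have Dsum: "D (sum f I) = (\<Sum>x\<in>I. D (f x))" for f :: "(nat \<Rightarrow> nat) \<Rightarrow> 'a" and I
    by (induction I rule: infinite_finite_induct) (auto simp: D0 add)
  define R where "R i = mat n n (\<lambda>(i', j). if i' = i then D (A $$ (i, j)) else A $$ (i', j))" for i
  have R: "R i \<in> carrier_mat n n" for i by (simp add: R_def)
  have laplace: "det (R i) = (\<Sum>j<n. D (A $$ (i, j)) * cofactor A i j)" if i: "i < n" for i
  proof -
    \<comment> \<open>\<open>R i\<close> differs from \<open>A\<close> only in row \<open>i\<close>,
      which these minors omit.\<close>
    have "mat_delete (R i) i j = mat_delete A i j" if "j < n" for j
      using i that A by (intro eq_matI) (auto simp: mat_delete_def R_def)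
    then have "cofactor (R i) i j = cofactor A i j" if "j < n" for j
      using that by (simp add: cofactor_def)
    then show ?thesis
      using laplace_expansion_row[OF R i, of i] i by (simp add: R_def)
  qed
  have leibniz: "det (R i) = (\<Sum>p | p permutes {0..<n}.
      signof p * (D (A $$ (i, p i)) * (\<Prod>l\<in>{0..<n} - {i}. A $$ (l, p l))))" if i: "i < n" for i
    unfolding det_def'[OF R]
  proof (intro sum.cong refl arg_cong2[where f = "(*)"])
    fix p assume "p \<in> {p. p permutes {0..<n}}"
    then have p: "p l < n" if "l < n" for l
      using that permutes_in_image[of p "{0..<n}" l] by auto
    have "(\<Prod>l = 0..<n. R i $$ (l, p l)) = R i $$ (i, p i) * (\<Prod>l\<in>{0..<n} - {i}. R i $$ (l, p l))"
      using i by (intro prod.remove) auto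
    also have "(\<Prod>l\<in>{0..<n} - {i}. R i $$ (l, p l)) = (\<Prod>l\<in>{0..<n} - {i}. A $$ (l, p l))"
      using p by (intro prod.cong) (auto simp: R_def)
    also have "R i $$ (i, p i) = D (A $$ (i, p i))"
      using i p by (simp add: R_def)
    finally show "(\<Prod>l = 0..<n. R i $$ (l, p l)) = D (A $$ (i, p i)) * (\<Prod>l\<in>{0..<n} - {i}. A $$ (l, p l))" .
  qed
  have "D (signof p * x) = signof p * D x" for p :: "nat \<Rightarrow> nat" and x
    by (cases p rule: sign_cases) (simp_all add: Dm)
  then have "D (det A) = (\<Sum>p | p permutes {0..<n}. \<Sum>i<n.
      signof p * (D (A $$ (i, p i)) * (\<Prod>l\<in>{0..<n} - {i}. A $$ (l, p l))))"
    unfolding det_def'[OF A] Dsum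
    by (simp add: derivation_prod[of D, OF mult] sum_distrib_left atLeast0LessThan)
  also have "\<dots> = (\<Sum>i<n. det (R i))"
    by (subst sum.swap) (simp add: leibniz)
  finally show ?thesis
    by (simp add: laplace)
qed

text \<open>This is \<open>p'(x) = tr adj(xI - A)\<close>: Jacobi's formula for d/dx on a matrix
  whose entries have derivative 1 on the diagonal and 0 elsewhere. The matrix is moved to formal
  power series because \<open>fps_deriv\<close> is a derivation even when the coefficient ring has
  zero divisors.\<close>

lemma sum_cofactor_diag_char_poly:
  fixes A :: "'a::comm_ring_1 mat"
  assumes A: "A \<in> carrier_mat n n"
  shows "(\<Sum>i<n. coeff (cofactor (char_poly_matrix A) i i) k) = of_nat (Suc k) * coeff (char_poly A) (Suc k)"
proof -
  interpret F: comm_ring_hom "fps_of_poly :: 'a poly \<Rightarrow> 'a fps"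
    by standard (auto simp: fps_of_poly_add fps_of_poly_mult)
  define M where "M = char_poly_matrix A"
  have M: "M \<in> carrier_mat n n" using A by (simp add: M_def)
  let ?F = "map_mat fps_of_poly M"
  have cof: "cofactor ?F i j = fps_of_poly (cofactor M i j)" for i j
  proof -
    have "mat_delete ?F i j = map_mat fps_of_poly (mat_delete M i j)"
      by (intro eq_matI) (auto simp: mat_delete_def)
    then show ?thesis
      by (simp add: cofactor_def F.hom_det F.hom_mult F.hom_power F.hom_uminus)
  qed
  have d: "fps_deriv (?F $$ (i, j)) = (if i = j then 1 else 0)" if "i < n" "j < n" for i j
    using that A by (auto simp: M_def char_poly_matrix_def fps_of_poly_add fps_of_poly_pCons fps_of_poly_linear)
  have "fps_deriv (fps_of_poly (char_poly A)) = fps_deriv (det ?F)"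
    by (simp add: F.hom_det char_poly_def M_def)
  also have "\<dots> = (\<Sum>i<n. \<Sum>j<n. fps_deriv (?F $$ (i, j)) * cofactor ?F i j)"
    using M by (intro derivation_det) (auto simp: algebra_simps)
  also have "\<dots> = (\<Sum>i<n. \<Sum>j<n. if i = j then fps_of_poly (cofactor M i i) else 0)"
    by (intro sum.cong refl) (auto simp: d cof)
  also have "\<dots> = (\<Sum>i<n. fps_of_poly (cofactor M i i))"
    by simp
  finally have "fps_nth (fps_deriv (fps_of_poly (char_poly A))) k
      = fps_nth (\<Sum>i<n. fps_of_poly (cofactor M i i)) k"
    by simp
  then show ?thesis
    by (simp add: fps_sum_nth M_def)
qed

text \<open>The coefficient matrices of \<open>x adj (x I - A)\<close>. The extra factor \<open>x\<close> makes the
  recursion read off from \<open>(x I - A) adj (x I - A) = p(x) I\<close> uniform in \<open>k\<close>.\<close>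

definition adj_coeff :: "'a::comm_ring_1 mat \<Rightarrow> nat \<Rightarrow> 'a mat" where
  "adj_coeff A k = map_mat (\<lambda>p. coeff (pCons 0 p) k) (adj_mat (char_poly_matrix A))"

lemma adj_coeff_carrier: "A \<in> carrier_mat n n \<Longrightarrow> adj_coeff A k \<in> carrier_mat n n"
  using adj_mat(1)[OF char_poly_matrix_closed] by (auto simp: adj_coeff_def)

lemma adj_coeff_0: "A \<in> carrier_mat n n \<Longrightarrow> adj_coeff A 0 = 0\<^sub>m n n"
  using adj_mat(1)[OF char_poly_matrix_closed, of A n] by (intro eq_matI) (auto simp: adj_coeff_def)

lemma adj_coeff_rec:
  fixes A :: "'a::comm_ring_1 mat"
  assumes A: "A \<in> carrier_mat n n"
  shows "adj_coeff A k = A * adj_coeff A (Suc k) + coeff (char_poly A) k \<cdot>\<^sub>m 1\<^sub>m n"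
proof -
  define M where "M = char_poly_matrix A"
  define N where "N = adj_mat M"
  have M: "M \<in> carrier_mat n n" using A by (simp add: M_def)
  have N: "N \<in> carrier_mat n n" using adj_mat(1)[OF M] by (simp add: N_def)
  have Mij: "M $$ (i, l) = (if i = l then [:0, 1:] else 0) + [:- (A $$ (i, l)):]" if "i < n" "l < n" for i l
    using that A by (auto simp: M_def char_poly_matrix_def)
  \<comment> \<open>Entry \<open>(i, j)\<close> of \<open>(xI - A) adj(xI - A) = p(x) I\<close>,
    with multiplication by \<open>x\<close> written as \<open>pCons 0\<close>; the coefficients at
    \<open>k\<close> give the recursion.\<close>
  have eq: "(if i = j then char_poly A else 0)
      = pCons 0 (N $$ (i, j)) - (\<Sum>l<n. Polynomial.smult (A $$ (i, l)) (N $$ (l, j)))"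
    if ij: "i < n" "j < n" for i j
  proof -
    have "(if i = j then char_poly A else 0) = (M * N) $$ (i, j)"
      using adj_mat(2)[OF M] M ij by (auto simp: N_def char_poly_def M_def)
    also have "\<dots> = (\<Sum>l<n. M $$ (i, l) * N $$ (l, j))"
      using ij M N by (auto simp: scalar_prod_def atLeast0LessThan)
    also have "\<dots> = (\<Sum>l<n. (if i = l then pCons 0 (N $$ (l, j)) else 0)
        - Polynomial.smult (A $$ (i, l)) (N $$ (l, j)))"
      using ij by (intro sum.cong refl) (auto simp: Mij algebra_simps)
    also have "\<dots> = pCons 0 (N $$ (i, j)) - (\<Sum>l<n. Polynomial.smult (A $$ (i, l)) (N $$ (l, j)))"
      using ij by (simp add: sum_subtractf)
    finally show ?thesis .
  qed
  have prod: "(A * adj_coeff A (Suc k)) $$ (i, j) = (\<Sum>l<n. A $$ (i, l) * coeff (N $$ (l, j)) k)"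
    if "i < n" "j < n" for i j
    using that A N by (auto simp: scalar_prod_def atLeast0LessThan adj_coeff_def N_def M_def)
  have ac: "adj_coeff A k $$ (i, j) = coeff (pCons 0 (N $$ (i, j))) k" if "i < n" "j < n" for i j
    using that N by (simp add: adj_coeff_def N_def M_def)
  note C = adj_coeff_carrier[OF A]
  show ?thesis
  proof (intro eq_matI)
    fix i j assume "i < dim_row (A * adj_coeff A (Suc k) + coeff (char_poly A) k \<cdot>\<^sub>m 1\<^sub>m n)"
      "j < dim_col (A * adj_coeff A (Suc k) + coeff (char_poly A) k \<cdot>\<^sub>m 1\<^sub>m n)"
    then have ij: "i < n" "j < n" by auto
    have "(A * adj_coeff A (Suc k) + coeff (char_poly A) k \<cdot>\<^sub>m 1\<^sub>m n) $$ (i, j)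
        = (\<Sum>l<n. A $$ (i, l) * coeff (N $$ (l, j)) k) + coeff (if i = j then char_poly A else 0) k"
      using ij A C[of "Suc k"] by (simp add: prod del: index_mult_mat(1))
    also have "\<dots> = adj_coeff A k $$ (i, j)"
      unfolding eq[OF ij] ac[OF ij] by (simp add: coeff_sum)
    finally show "adj_coeff A k $$ (i, j) = (A * adj_coeff A (Suc k) + coeff (char_poly A) k \<cdot>\<^sub>m 1\<^sub>m n) $$ (i, j)"
      by simp
  qed (use A C in auto)
qed

text \<open>The sum of the degrees of all entries is a crude common bound; it suffices for
  discarding the remainder in \<open>adj_coeff_expand\<close>.\<close>

lemma adj_coeff_eventually_0:
  fixes A :: "'a::comm_ring_1 mat"
  assumes A: "A \<in> carrier_mat n n"
  shows "\<exists>K. \<forall>k\<ge>K. adj_coeff A k = 0\<^sub>m n n"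
proof -
  let ?N = "adj_mat (char_poly_matrix A)"
  have N: "?N \<in> carrier_mat n n" using adj_mat(1)[OF char_poly_matrix_closed[OF A]] .
  let ?d = "\<lambda>i j. degree (pCons 0 (?N $$ (i, j)))"
  define K where "K = Suc (\<Sum>i<n. \<Sum>j<n. ?d i j)"
  have deg: "?d i j < K" if "i < n" "j < n" for i j
  proof -
    have "?d i j \<le> (\<Sum>j<n. ?d i j)"
      using that by (intro member_le_sum) auto
    also have "\<dots> \<le> (\<Sum>i<n. \<Sum>j<n. ?d i j)"
      using that by (intro member_le_sum[of i "{..<n}" "\<lambda>i. \<Sum>j<n. ?d i j"]) auto
    finally show ?thesis unfolding K_def by simp
  qed
  have "adj_coeff A k = 0\<^sub>m n n" if "k \<ge> K" for k
  proof (intro eq_matI)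
    fix i j assume "i < dim_row (0\<^sub>m n n :: 'a mat)" "j < dim_col (0\<^sub>m n n :: 'a mat)"
    then show "adj_coeff A k $$ (i, j) = 0\<^sub>m n n $$ (i, j)"
      using deg[of i j] that N coeff_eq_0[of "pCons 0 (?N $$ (i, j))" k] by (simp add: adj_coeff_def)
  qed (use adj_coeff_carrier[OF A, of k] in auto)
  then show ?thesis by blast
qed

lemma mat_pow_Suc_left:
  assumes A: "A \<in> carrier_mat n n"
  shows "A ^\<^sub>m Suc k = A * A ^\<^sub>m k"
proof (induction k)
  case 0
  show ?case using A by simp
next
  case (Suc k)
  have "A ^\<^sub>m Suc (Suc k) = (A * A ^\<^sub>m k) * A" using Suc by simp
  also have "\<dots> = A * (A ^\<^sub>m k * A)" using A by (intro assoc_mult_mat) auto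
  finally show ?case by simp
qed

text \<open>Horner's scheme: the recursion unrolled \<open>L\<close> times, keeping the
  remainder.\<close>

lemma adj_coeff_expand:
  fixes A :: "'a::comm_ring_1 mat"
  assumes A: "A \<in> carrier_mat n n" and ij: "i < n" "j < n"
  shows "adj_coeff A k $$ (i, j) = (\<Sum>m<L. coeff (char_poly A) (k + m) * (A ^\<^sub>m m) $$ (i, j))
    + (A ^\<^sub>m L * adj_coeff A (k + L)) $$ (i, j)"
proof (induction L)
  case 0
  show ?case using adj_coeff_carrier[OF A, of k] A by simp
next
  case (Suc L)
  let ?c = "coeff (char_poly A) (k + L)"
  note C = adj_coeff_carrier[OF A]
  have P: "A ^\<^sub>m L \<in> carrier_mat n n" using A by simp
  have "A ^\<^sub>m L * adj_coeff A (k + L) = A ^\<^sub>m L * (A * adj_coeff A (Suc (k + L)) + ?c \<cdot>\<^sub>m 1\<^sub>m n)"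
    by (subst adj_coeff_rec[OF A]) simp
  also have "\<dots> = A ^\<^sub>m L * (A * adj_coeff A (Suc (k + L))) + A ^\<^sub>m L * (?c \<cdot>\<^sub>m 1\<^sub>m n)"
    using A C[of "Suc (k + L)"] P by (intro mult_add_distrib_mat) auto
  also have "A ^\<^sub>m L * (A * adj_coeff A (Suc (k + L))) = A ^\<^sub>m Suc L * adj_coeff A (Suc (k + L))"
    using assoc_mult_mat[OF P A C[of "Suc (k + L)"]] by simp
  also have "A ^\<^sub>m L * (?c \<cdot>\<^sub>m 1\<^sub>m n) = ?c \<cdot>\<^sub>m A ^\<^sub>m L"
    using mult_smult_distrib[OF P one_carrier_mat[of n]] right_mult_one_mat[OF P] by simp
  finally have "(A ^\<^sub>m L * adj_coeff A (k + L)) $$ (i, j)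
      = (A ^\<^sub>m Suc L * adj_coeff A (k + Suc L)) $$ (i, j) + ?c * (A ^\<^sub>m L) $$ (i, j)"
    using ij A C[of "Suc (k + L)"] P by (simp del: index_mult_mat(1) assoc_mult_mat pow_mat.simps)
  then show ?case
    using Suc by (simp del: index_mult_mat(1) add: algebra_simps)
qed

lemma adj_coeff_eq_sum:
  fixes A :: "'a::comm_ring_1 mat"
  assumes A: "A \<in> carrier_mat n n" and ij: "i < n" "j < n" and k: "k \<le> n"
  shows "adj_coeff A k $$ (i, j) = (\<Sum>m\<le>n - k. coeff (char_poly A) (k + m) * (A ^\<^sub>m m) $$ (i, j))"
proof -
  obtain K where K: "\<And>l. l \<ge> K \<Longrightarrow> adj_coeff A l = 0\<^sub>m n n"
    using adj_coeff_eventually_0[OF A] by blast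
  \<comment> \<open>\<open>K\<close> makes the remainder vanish; \<open>Suc n\<close> makes the
    range of \<open>m\<close> contain all of \<open>{..n - k}\<close>. The surplus terms lie beyond
    the degree \<open>n\<close>.\<close>
  define L where "L = Suc (n + K)"
  have P: "A ^\<^sub>m L \<in> carrier_mat n n" using A by simp
  have "adj_coeff A (k + L) = 0\<^sub>m n n" by (intro K) (simp add: L_def)
  then have "(A ^\<^sub>m L * adj_coeff A (k + L)) $$ (i, j) = 0"
    using right_mult_zero_mat[OF P, of n] ij by simp
  then have "adj_coeff A k $$ (i, j) = (\<Sum>m<L. coeff (char_poly A) (k + m) * (A ^\<^sub>m m) $$ (i, j))"
    using adj_coeff_expand[OF A ij, of k L] by simp
  also have "\<dots> = (\<Sum>m\<le>n - k. coeff (char_poly A) (k + m) * (A ^\<^sub>m m) $$ (i, j))"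
  proof (intro sum.mono_neutral_right ballI)
    fix m assume "m \<in> {..<L} - {..n - k}"
    then have "degree (char_poly A) < k + m"
      using degree_monic_char_poly[OF A] by auto
    then show "coeff (char_poly A) (k + m) * (A ^\<^sub>m m) $$ (i, j) = 0"
      by (simp add: coeff_eq_0)
  qed (auto simp: L_def)
  finally show ?thesis .
qed

text \<open>At \<open>k = 0\<close> the Horner sum is \<open>p(A)\<close>, while
  \<open>x adj(xI - A)\<close> has no constant term.\<close>

theorem cayley_hamilton:
  fixes A :: "'a::comm_ring_1 mat"
  assumes "A \<in> carrier_mat n n" and "i < n" "j < n"
  shows "(\<Sum>k\<le>n. coeff (char_poly A) k * (A ^\<^sub>m k) $$ (i, j)) = 0"
  using adj_coeff_eq_sum[OF assms, of 0] assms by (simp add: adj_coeff_0)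

text \<open>The trace of \<open>adj_coeff A k\<close> is computed twice: as a coefficient of
  \<open>x p'(x)\<close> it is \<open>k\<close> times the coefficient of \<open>p\<close>, and the
  Horner sum expresses it by traces of powers. Nothing is divided, so this holds over any
  commutative ring.\<close>

theorem newton_identity:
  fixes A :: "'a::comm_ring_1 mat"
  assumes A: "A \<in> carrier_mat n n" and k: "k \<le> n"
  shows "of_nat (n - k) * coeff (char_poly A) k
    = - (\<Sum>m\<in>{1..n - k}. coeff (char_poly A) (k + m) * (\<Sum>i<n. (A ^\<^sub>m m) $$ (i, i)))"
proof -
  let ?c = "coeff (char_poly A)"
  have "(\<Sum>i<n. adj_coeff A k $$ (i, i)) = of_nat k * ?c k"
  proof (cases k)
    case 0
    then show ?thesis using A by (simp add: adj_coeff_0)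
  next
    case (Suc l)
    have "dim_row (char_poly_matrix A) = n" "dim_col (char_poly_matrix A) = n"
      using char_poly_matrix_closed[OF A] by auto
    then have "(\<Sum>i<n. adj_coeff A k $$ (i, i)) = (\<Sum>i<n. coeff (cofactor (char_poly_matrix A) i i) l)"
      using Suc by (intro sum.cong) (auto simp: adj_coeff_def adj_mat_def)
    then show ?thesis
      using sum_cofactor_diag_char_poly[OF A] Suc by simp
  qed
  then have "of_nat k * ?c k = (\<Sum>i<n. \<Sum>m\<le>n - k. ?c (k + m) * (A ^\<^sub>m m) $$ (i, i))"
    using adj_coeff_eq_sum[OF A _ _ k] by simp
  also have "\<dots> = (\<Sum>m\<le>n - k. ?c (k + m) * (\<Sum>i<n. (A ^\<^sub>m m) $$ (i, i)))"
    by (subst sum.swap) (simp add: sum_distrib_left)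
  \<comment> \<open>The term \<open>m = 0\<close> contains the trace \<open>n\<close> of the
    identity; moving it across yields the factor \<open>n - k\<close>.\<close>
  also have "{..n - k} = insert 0 {1..n - k}" by auto
  finally show ?thesis
    using A k by (simp add: of_nat_diff algebra_simps)
qed

section \<open>Twisted products of functions on finite sets\<close>

text \<open>The sign is a parameter so that the Grassmann product and its truncation share one proof
  of the ring laws.\<close>

definition twisted_mult :: "(nat set \<Rightarrow> nat set \<Rightarrow> 'k::comm_ring_1) \<Rightarrow> 'k grass \<Rightarrow> 'k grass \<Rightarrow> 'k grass" where
  "twisted_mult w f g = (\<lambda>S. if finite S then (\<Sum>A\<in>Pow S. w A (S - A) * f A * g (S - A)) else 0)"

text \<open>Associativity on basis vectors. Only disjoint finite sets matter, since a product only
  splits a finite set into complementary parts.\<close>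

definition cocycle :: "(nat set \<Rightarrow> nat set \<Rightarrow> 'k::comm_ring_1) \<Rightarrow> bool" where
  "cocycle w \<longleftrightarrow> (\<forall>A B C. finite A \<and> finite B \<and> finite C \<and> A \<inter> B = {} \<and> A \<inter> C = {} \<and> B \<inter> C = {}
     \<longrightarrow> w A B * w (A \<union> B) C = w A (B \<union> C) * w B C)"

text \<open>Both sides sum over ordered partitions of \<open>S\<close> into three blocks; the
  cocycle law equates the weights.\<close>

lemma twisted_mult_assoc:
  fixes w :: "nat set \<Rightarrow> nat set \<Rightarrow> 'k::comm_ring_1"
  assumes w: "cocycle w"
  shows "twisted_mult w (twisted_mult w f g) h = twisted_mult w f (twisted_mult w g h)"
proof (intro ext)
  fix S :: "nat set"
  show "twisted_mult w (twisted_mult w f g) h S = twisted_mult w f (twisted_mult w g h) S"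
  proof (cases "finite S")
    case True
    have fin: "finite D" if "D \<subseteq> S" for D using that True finite_subset by blast
    have "twisted_mult w (twisted_mult w f g) h S
        = (\<Sum>D\<in>Pow S. \<Sum>A\<in>Pow D. w D (S - D) * (w A (D - A) * f A * g (D - A)) * h (S - D))"
      using True fin by (auto simp: twisted_mult_def sum_distrib_left sum_distrib_right intro!: sum.cong)
    also have "\<dots> = (\<Sum>(D, A)\<in>(SIGMA D:Pow S. Pow D). w D (S - D) * (w A (D - A) * f A * g (D - A)) * h (S - D))"
      using True fin by (subst sum.Sigma) auto
    also have "\<dots> = (\<Sum>(A, B)\<in>(SIGMA A:Pow S. Pow (S - A)).
        w A (S - A) * f A * (w B (S - A - B) * g B * h (S - A - B)))"
    \<comment> \<open>The blocks are \<open>A\<close>, \<open>D - A\<close>, \<open>S - D\<close>.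
      Goal 5 compares the summands; the other goals say that the two maps are mutually
      inverse.\<close>
    proof (rule sum.reindex_bij_witness[of _ "\<lambda>(A, B). (A \<union> B, A)" "\<lambda>(D, A). (A, D - A)"], goal_cases)
      case (5 p)
      then obtain D A where p: "p = (D, A)" "D \<subseteq> S" "A \<subseteq> D" by auto
      have sets: "A \<union> (D - A) = D" "S - A - (D - A) = S - D" "(D - A) \<union> (S - D) = S - A"
        using p by auto
      have "w A (D - A) * w (A \<union> (D - A)) (S - D) = w A ((D - A) \<union> (S - D)) * w (D - A) (S - D)"
        using p True fin by (intro w[unfolded cocycle_def, rule_format]) auto
      then have w': "w D (S - D) * w A (D - A) = w A (S - A) * w (D - A) (S - D)"
        unfolding sets by (simp only: mult.commute)
      have key: "x * (y * f A * g (D - A)) * h (S - D) = z * f A * (u * g (D - A) * h (S - D))"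
        if "x * y = z * u" for x y z u
      proof -
        have "x * (y * f A * g (D - A)) * h (S - D) = (x * y) * (f A * g (D - A) * h (S - D))"
          by (simp only: mult_ac)
        also have "\<dots> = z * f A * (u * g (D - A) * h (S - D))"
          unfolding that by (simp only: mult_ac)
        finally show ?thesis .
      qed
      show ?case
        unfolding p(1) prod.case sets by (rule key[OF w', symmetric])
    qed auto
    also have "\<dots> = (\<Sum>A\<in>Pow S. \<Sum>B\<in>Pow (S - A).
        w A (S - A) * f A * (w B (S - A - B) * g B * h (S - A - B)))"
      using True fin by (subst sum.Sigma) auto
    also have "\<dots> = twisted_mult w f (twisted_mult w g h) S"
      using True fin by (auto simp: twisted_mult_def sum_distrib_left intro!: sum.cong)
    finally show ?thesis .
  qed (simp add: twisted_mult_def)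
qed

lemma twisted_mult_add_left: "twisted_mult w (f + g) h = twisted_mult w f h + twisted_mult w g h"
  by (auto simp: twisted_mult_def algebra_simps sum.distrib fun_eq_iff)

lemma twisted_mult_add_right: "twisted_mult w h (f + g) = twisted_mult w h f + twisted_mult w h g"
  by (auto simp: twisted_mult_def algebra_simps sum.distrib fun_eq_iff)

lemma twisted_mult_commute:
  assumes "\<And>A B. finite A \<Longrightarrow> finite B \<Longrightarrow> A \<inter> B = {} \<Longrightarrow> w A B = w B A"
  shows "twisted_mult w f g = twisted_mult w g f"
proof (intro ext)
  fix S :: "nat set"
  show "twisted_mult w f g S = twisted_mult w g f S"
  proof (cases "finite S")
    case True
    have "(\<Sum>A\<in>Pow S. w A (S - A) * f A * g (S - A)) = (\<Sum>A\<in>Pow S. w A (S - A) * g A * f (S - A))"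
    proof (rule sum.reindex_bij_witness[of _ "\<lambda>A. S - A" "\<lambda>A. S - A"], goal_cases)
      case (5 A)
      then have "A \<subseteq> S" "finite A" "S - (S - A) = A" using True finite_subset by auto
      then show ?case using assms[of A "S - A"] True by (simp add: mult_ac)
    qed auto
    then show ?thesis using True by (simp add: twisted_mult_def)
  qed (simp add: twisted_mult_def)
qed

lemma twisted_mult_one_left:
  assumes "\<And>S. w {} S = 1" and "\<And>S. infinite S \<Longrightarrow> f S = 0"
  shows "twisted_mult w gone f = f"
proof (intro ext)
  fix S :: "nat set"
  show "twisted_mult w gone f S = f S"
  proof (cases "finite S")
    case True
    have "(\<Sum>A\<in>Pow S. w A (S - A) * gone A * f (S - A)) = (\<Sum>A\<in>{{}}. w A (S - A) * gone A * f (S - A))"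
      using True by (intro sum.mono_neutral_right) (auto simp: gone_def)
    then show ?thesis using True assms by (simp add: twisted_mult_def gone_def)
  qed (simp add: twisted_mult_def assms)
qed

section \<open>The Grassmann sign and its truncation\<close>

definition gsign :: "nat set \<Rightarrow> nat set \<Rightarrow> 'k::comm_ring_1" where
  "gsign A B = (-1) ^ inv_count A B"

text \<open>The value 0 on two odd sets encodes \<open>\<theta>^2 = 0\<close>. Even elements commute
  with \<open>\<theta>\<close>, so all other products keep the Grassmann sign.\<close>

definition esign :: "nat set \<Rightarrow> nat set \<Rightarrow> 'k::comm_ring_1" where
  "esign A B = (if odd (card A) \<and> odd (card B) then 0 else gsign A B)"

lemma gmul_eq_twisted_mult: "gmul = twisted_mult gsign"
  by (intro ext) (simp add: gmul_def twisted_mult_def gsign_def)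

lemma finite_inv_pairs: "finite A \<Longrightarrow> finite B \<Longrightarrow> finite {(a, b). a \<in> A \<and> b \<in> B \<and> b < a}" for A B :: "nat set"
  by (rule finite_subset[of _ "A \<times> B"]) auto

lemma inv_count_Un_left:
  assumes "finite A" "finite B" "finite C" "A \<inter> B = {}"
  shows "inv_count (A \<union> B) C = inv_count A C + inv_count B C"
  unfolding inv_count_def
  by (subst card_Un_disjoint[symmetric]) (use assms finite_inv_pairs in \<open>auto intro!: arg_cong[where f = card]\<close>)

lemma inv_count_Un_right:
  assumes "finite A" "finite B" "finite C" "B \<inter> C = {}"
  shows "inv_count A (B \<union> C) = inv_count A B + inv_count A C"
  unfolding inv_count_def
  by (subst card_Un_disjoint[symmetric]) (use assms finite_inv_pairs in \<open>auto intro!: arg_cong[where f = card]\<close>)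

text \<open>Each pair in \<open>A \<times> B\<close> is an inversion in exactly one of the two
  orders.\<close>

lemma inv_count_swap:
  assumes "finite A" "finite B" "A \<inter> B = {}"
  shows "inv_count A B + inv_count B A = card A * card B"
proof -
  have "inv_count B A = card {(a, b). a \<in> A \<and> b \<in> B \<and> a < b}"
    unfolding inv_count_def by (rule bij_betw_same_card[of prod.swap]) (auto simp: bij_betw_def inj_on_def image_iff)
  then have "inv_count A B + inv_count B A
      = card ({(a, b). a \<in> A \<and> b \<in> B \<and> b < a} \<union> {(a, b). a \<in> A \<and> b \<in> B \<and> a < b})"
    unfolding inv_count_def
    by (subst card_Un_disjoint) (auto intro: finite_subset[of _ "A \<times> B"] simp: assms)
  also have "{(a, b). a \<in> A \<and> b \<in> B \<and> b < a} \<union> {(a, b). a \<in> A \<and> b \<in> B \<and> a < b} = A \<times> B"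
    using assms(3) by (auto simp: disjoint_iff) (metis linorder_neqE_nat)
  finally show ?thesis by (simp add: card_cartesian_product)
qed

lemma inv_count_empty: "inv_count {} S = 0"
  by (simp add: inv_count_def)

lemma cocycle_gsign: "cocycle (gsign :: _ \<Rightarrow> _ \<Rightarrow> 'k::comm_ring_1)"
  by (auto simp: cocycle_def gsign_def inv_count_Un_left inv_count_Un_right simp flip: power_add intro: arg_cong)

text \<open>If two of the three sets have odd size, both sides vanish; otherwise no factor is
  truncated and the law for \<open>gsign\<close> applies.\<close>

lemma cocycle_esign: "cocycle (esign :: _ \<Rightarrow> _ \<Rightarrow> 'k::comm_ring_1)"
  using cocycle_gsign[where 'k = 'k]
  by (auto simp: cocycle_def esign_def card_Un_disjoint)

text \<open>Once one size is even, the inversion counts in the two orders add up to an even number,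
  so the signs agree.\<close>

lemma esign_commute:
  assumes "finite A" "finite B" "A \<inter> B = {}"
  shows "esign A B = (esign B A :: 'k::comm_ring_1)"
proof (cases "odd (card A) \<and> odd (card B)")
  case False
  then have "even (inv_count A B + inv_count B A)"
    using inv_count_swap[OF assms] by simp
  then show ?thesis
    using False by (auto simp: esign_def gsign_def minus_one_power_iff)
qed (simp add: esign_def)

lemma gmul_assoc: "gmul (gmul f g) h = gmul f (gmul g h)"
  unfolding gmul_eq_twisted_mult by (rule twisted_mult_assoc[OF cocycle_gsign])

definition gsupp :: "'k::zero grass \<Rightarrow> bool" where
  "gsupp f \<longleftrightarrow> (\<forall>S. infinite S \<longrightarrow> f S = 0)"

text \<open>The trivial extension \<open>E\<^sub>0 \<oplus> \<theta> E\<^sub>1\<close>, with \<open>f\<^sub>0 + \<theta> f\<^sub>1\<close> stored as \<open>f\<^sub>0 + f\<^sub>1\<close>.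
  Infinite linear combinations of basis vectors are allowed; only coordinates at infinite sets
  must vanish, as they do in every product.\<close>

typedef (overloaded) 'k gext = "{f :: 'k::zero grass. gsupp f}"
  morphisms Rep_gext Abs_gext
  by (rule exI[of _ "\<lambda>_. 0"]) (simp add: gsupp_def)

setup_lifting type_definition_gext

instantiation gext :: (comm_ring_1) comm_ring_1
begin

lift_definition zero_gext :: "'a gext" is 0 by (simp add: gsupp_def)
lift_definition one_gext :: "'a gext" is gone by (auto simp: gsupp_def gone_def)
lift_definition plus_gext :: "'a gext \<Rightarrow> 'a gext \<Rightarrow> 'a gext" is "(+)" by (simp add: gsupp_def)
lift_definition minus_gext :: "'a gext \<Rightarrow> 'a gext \<Rightarrow> 'a gext" is "(-)" by (simp add: gsupp_def)
lift_definition uminus_gext :: "'a gext \<Rightarrow> 'a gext" is "uminus" by (simp add: gsupp_def)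
lift_definition times_gext :: "'a gext \<Rightarrow> 'a gext \<Rightarrow> 'a gext" is "twisted_mult esign" by (simp add: gsupp_def twisted_mult_def)

instance
proof
  fix a b c :: "'a gext"
  show "a * b * c = a * (b * c)" by transfer (rule twisted_mult_assoc[OF cocycle_esign])
  show "a * b = b * a" by transfer (rule twisted_mult_commute[OF esign_commute])
  show "1 * a = a" by transfer (rule twisted_mult_one_left, auto simp: gsupp_def esign_def gsign_def inv_count_empty)
  show "a + b + c = a + (b + c)" by transfer (simp add: add.assoc)
  show "a + b = b + a" by transfer (simp add: add.commute)
  show "0 + a = a" by transfer simp
  show "- a + a = 0" by transfer simp
  show "a - b = a + - b" by transfer simp
  show "(a + b) * c = a * c + b * c" by transfer (rule twisted_mult_add_left)
  show "(0::'a gext) \<noteq> 1" by transfer (auto simp: gone_def fun_eq_iff)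
qed

end

section \<open>Parity\<close>

lemma sum_fun_apply: "sum f I x = (\<Sum>i\<in>I. f i x)"
  by (induction I rule: infinite_finite_induct) auto

lemma twisted_mult_zero_left: "twisted_mult w 0 f = 0"
  and twisted_mult_zero_right: "twisted_mult w f 0 = 0"
  by (auto simp: twisted_mult_def)

lemma gmul_sum_left: "gmul (sum f I) h = (\<Sum>i\<in>I. gmul (f i) h)"
  unfolding gmul_eq_twisted_mult
  by (induction I rule: infinite_finite_induct)
    (simp_all only: twisted_mult_zero_left sum.infinite sum.empty sum.insert twisted_mult_add_left not_False_eq_True)

lemma gmul_sum_right: "gmul h (sum f I) = (\<Sum>i\<in>I. gmul h (f i))"
  unfolding gmul_eq_twisted_mult
  by (induction I rule: infinite_finite_induct)
    (simp_all only: twisted_mult_zero_right sum.infinite sum.empty sum.insert twisted_mult_add_right not_False_eq_True)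

lemma gmul_gscale_right: "gmul f (gscale c g) = gscale c (gmul f g)"
  by (auto simp: gmul_def gscale_def sum_distrib_left fun_eq_iff mult_ac)

lemma gscale_sum: "gscale c (sum f I) = (\<Sum>i\<in>I. gscale c (f i))"
  by (auto simp: gscale_def sum_fun_apply sum_distrib_left fun_eq_iff)

lemma gscale_left_commute: "gscale a (gscale b f) = gscale b (gscale a f)"
  by (simp add: gscale_def mult.left_commute)

text \<open>Parity is given by a number so that it adds along products. As in \<open>gext\<close>,
  infinite support is allowed.\<close>

definition has_parity :: "nat \<Rightarrow> 'k::zero grass \<Rightarrow> bool" where
  "has_parity p f \<longleftrightarrow> (\<forall>S. f S \<noteq> 0 \<longrightarrow> finite S \<and> (even (card S) \<longleftrightarrow> even p))"

lemma has_parity_gsupp: "has_parity p f \<Longrightarrow> gsupp f"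
  by (auto simp: has_parity_def gsupp_def)

lemma has_parity_cong: "has_parity p f \<Longrightarrow> even p = even q \<Longrightarrow> has_parity q f"
  by (simp add: has_parity_def)

lemma has_parity_sum: "(\<And>i. i \<in> I \<Longrightarrow> has_parity p (f i)) \<Longrightarrow> has_parity p (sum f I)"
  unfolding has_parity_def sum_fun_apply by (metis sum.not_neutral_contains_not_neutral)

lemma has_parity_gmul:
  assumes f: "has_parity p f" and g: "has_parity q g"
  shows "has_parity (p + q) (gmul f g)"
  unfolding has_parity_def
proof (intro allI impI)
  fix S assume nz: "gmul f g S \<noteq> 0"
  then have S: "finite S" by (auto simp: gmul_def split: if_splits)
  with nz obtain A where "A \<subseteq> S" "(-1) ^ inv_count A (S - A) * f A * g (S - A) \<noteq> 0"
    by (auto simp: gmul_def elim!: sum.not_neutral_contains_not_neutral)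
  then have A: "A \<subseteq> S" "f A \<noteq> 0" "g (S - A) \<noteq> 0"
    by auto
  have "card S = card A + card (S - A)"
    using A S by (metis card_Diff_subset card_mono finite_subset le_add_diff_inverse)
  then show "finite S \<and> (even (card S) \<longleftrightarrow> even (p + q))"
    using f g A S by (auto simp: has_parity_def)
qed

lemma gmat_pow_parity:
  assumes B: "\<forall>i<n. \<forall>j<n. has_parity 1 (B i j)" and "i < n" "j < n"
  shows "has_parity k (gmat_pow n B k i j)"
  using assms(2,3)
proof (induction k arbitrary: i j)
  case 0
  then show ?case by (auto simp: gmat_id_def has_parity_def gone_def)
next
  case (Suc k)
  then have "has_parity (1 + k) (gmul (B i l) (gmat_pow n B k l j))" if "l < n" for l
    using that B by (intro has_parity_gmul) auto
  then show ?case
    unfolding gmat_pow.simps gmat_mult_def by (intro has_parity_sum) auto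
qed

lemma gmat_mult_assoc: "gmat_mult n (gmat_mult n A B) C = gmat_mult n A (gmat_mult n B C)"
proof (rule ext, rule ext)
  fix i j
  show "gmat_mult n (gmat_mult n A B) C i j = gmat_mult n A (gmat_mult n B C) i j"
    unfolding gmat_mult_def gmul_sum_left gmul_sum_right gmul_assoc by (rule sum.swap)
qed

text \<open>Induction on \<open>a\<close> by associativity. At \<open>a = 0\<close> the unit law
  holds for functions vanishing at infinite sets, which the parity of the entries
  guarantees.\<close>

lemma gmat_pow_add:
  fixes B :: "'k::comm_ring_1 gmat"
  assumes B: "\<forall>i<n. \<forall>j<n. has_parity 1 (B i j)" and "i < n" "j < n"
  shows "gmat_mult n (gmat_pow n B a) (gmat_pow n B b) i j = gmat_pow n B (a + b) i j"
  using assms(2,3)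
proof (induction a arbitrary: i j)
  case 0
  have z: "gmul 0 f = 0" for f :: "'k grass" by (simp add: gmul_eq_twisted_mult twisted_mult_zero_left)
  have "gsupp (gmat_pow n B b i j)"
    using 0 by (intro has_parity_gsupp[of b] gmat_pow_parity B)
  then have one: "gmul gone (gmat_pow n B b i j) = gmat_pow n B b i j"
    unfolding gmul_eq_twisted_mult by (intro twisted_mult_one_left) (auto simp: gsign_def inv_count_empty gsupp_def)
  have "gmat_mult n (gmat_pow n B 0) (gmat_pow n B b) i j
      = (\<Sum>l<n. if l = i then gmul gone (gmat_pow n B b i j) else 0)"
    unfolding gmat_mult_def gmat_pow.simps gmat_id_def by (intro sum.cong) (auto simp: z)
  then show ?case
    using 0 one by (simp add: sum.delta)
next
  case (Suc a)
  have "gmat_mult n (gmat_pow n B (Suc a)) (gmat_pow n B b) i j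
      = gmat_mult n B (gmat_mult n (gmat_pow n B a) (gmat_pow n B b)) i j"
    by (simp add: gmat_mult_assoc)
  also have "\<dots> = gmat_mult n B (gmat_pow n B (a + b)) i j"
    unfolding gmat_mult_def[of n B] using Suc by (intro sum.cong) auto
  finally show ?case by simp
qed

section \<open>Products and parity parts in the trivial extension\<close>

lemma Rep_gext_sum: "Rep_gext (sum f I) = (\<Sum>i\<in>I. Rep_gext (f i))"
  by (induction I rule: infinite_finite_induct) (auto simp: zero_gext.rep_eq plus_gext.rep_eq)

lemma Rep_Abs_gext: "gsupp f \<Longrightarrow> Rep_gext (Abs_gext f) = f"
  by (simp add: Abs_gext_inverse)

lemma gsupp_Rep: "gsupp (Rep_gext x)"
  using Rep_gext[of x] by simp

lemma gsupp_sum: "(\<And>i. i \<in> I \<Longrightarrow> gsupp (f i)) \<Longrightarrow> gsupp (sum f I)"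
  by (simp add: gsupp_def sum_fun_apply)

lemma Abs_gext_sum: "(\<And>i. i \<in> I \<Longrightarrow> gsupp (f i)) \<Longrightarrow> Abs_gext (sum f I) = (\<Sum>i\<in>I. Abs_gext (f i))"
  by (subst Rep_gext_inject[symmetric]) (simp add: Rep_gext_sum Rep_Abs_gext gsupp_sum)

lemma Rep_gext_of_nat_mult: "Rep_gext (of_nat k * x) = gscale (of_nat k) (Rep_gext x)"
  by (induction k) (auto simp: zero_gext.rep_eq plus_gext.rep_eq gscale_def algebra_simps)

text \<open>\<open>esign\<close> and \<open>gsign\<close> differ only on two odd sets, which do not
  meet when one factor is even. Through this lemma, identities in the commutative ring become
  identities in E.\<close>

lemma Rep_gext_mult_even:
  assumes "has_parity 0 (Rep_gext x) \<or> has_parity 0 (Rep_gext y)"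
  shows "Rep_gext (x * y) = gmul (Rep_gext x) (Rep_gext y)"
  unfolding times_gext.rep_eq gmul_eq_twisted_mult twisted_mult_def
proof (intro ext if_cong refl sum.cong)
  fix S A :: "nat set" assume "A \<in> Pow S"
  show "esign A (S - A) * Rep_gext x A * Rep_gext y (S - A) = gsign A (S - A) * Rep_gext x A * Rep_gext y (S - A)"
    using assms by (cases "Rep_gext x A = 0 \<or> Rep_gext y (S - A) = 0") (auto simp: has_parity_def esign_def)
qed

lemma Rep_gext_mult_odd:
  assumes "has_parity 1 (Rep_gext x)" "has_parity 1 (Rep_gext y)"
  shows "x * y = 0"
proof -
  have *: "esign A (S - A) * Rep_gext x A * Rep_gext y (S - A) = 0" for A S
    using assms by (cases "Rep_gext x A = 0 \<or> Rep_gext y (S - A) = 0") (auto simp: has_parity_def esign_def)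
  show ?thesis
    by (subst Rep_gext_inject[symmetric]) (auto simp: times_gext.rep_eq twisted_mult_def zero_gext.rep_eq * fun_eq_iff)
qed

lift_definition even_part :: "'k::zero gext \<Rightarrow> 'k gext" is "\<lambda>f S. if even (card S) then f S else 0"
  by (auto simp: gsupp_def)

lift_definition odd_part :: "'k::zero gext \<Rightarrow> 'k gext" is "\<lambda>f S. if odd (card S) then f S else 0"
  by (auto simp: gsupp_def)

lemma even_part_add: "even_part (x + y) = even_part x + even_part y"
  by transfer (auto simp: fun_eq_iff)

lemma odd_part_add: "odd_part (x + y) = odd_part x + odd_part y"
  by transfer (auto simp: fun_eq_iff)

lemma odd_part_0: "odd_part 0 = 0"
  by transfer auto

lemma odd_part_1: "odd_part 1 = 0"
  by transfer (auto simp: gone_def fun_eq_iff)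

lemma odd_part_sum: "odd_part (sum f I) = (\<Sum>i\<in>I. odd_part (f i))"
  by (induction I rule: infinite_finite_induct) (auto simp: odd_part_add odd_part_0)

lemma odd_part_uminus: "odd_part (- x) = - odd_part x"
  by transfer (auto simp: fun_eq_iff)

lemma odd_part_of_nat_mult: "odd_part (of_nat k * x) = of_nat k * odd_part x"
  by (induction k) (auto simp: odd_part_0 odd_part_add algebra_simps)

lemma card_Diff_parity: "finite S \<Longrightarrow> A \<subseteq> S \<Longrightarrow> even (card S) \<longleftrightarrow> (even (card A) \<longleftrightarrow> even (card (S - A)))"
  by (metis card_Diff_subset card_mono even_diff_nat even_add finite_subset le_add_diff_inverse)

text \<open>An even set splits into two even or two odd sets, and \<open>esign\<close> kills the
  latter: \<open>even_part\<close> is reduction modulo \<open>\<theta>\<close>.\<close>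

lemma even_part_mult: "even_part (x * y) = even_part x * even_part y"
proof (transfer, intro ext)
  fix f g :: "'a grass" and S
  show "(if even (card S) then twisted_mult esign f g S else 0)
    = twisted_mult esign (\<lambda>S. if even (card S) then f S else 0) (\<lambda>S. if even (card S) then g S else 0) S"
    by (auto simp: twisted_mult_def card_Diff_parity esign_def intro!: sum.cong sum.neutral)
qed

text \<open>The product rule for the \<open>\<theta>\<close>-part: an odd set splits into one even
  and one odd set.\<close>

lemma odd_part_mult: "odd_part (x * y) = even_part x * odd_part y + odd_part x * even_part y"
proof (transfer, intro ext)
  fix f g :: "'a grass" and S
  let ?e = "\<lambda>f S. if even (card S) then f S else 0" and ?o = "\<lambda>f S. if odd (card S) then f S else 0"
  show "(if odd (card S) then twisted_mult esign f g S else 0)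
    = (twisted_mult esign (?e f) (?o g) + twisted_mult esign (?o f) (?e g)) S"
    by (auto simp: twisted_mult_def card_Diff_parity esign_def simp flip: sum.distrib intro!: sum.cong sum.neutral)
qed

lemma comm_ring_hom_even_part: "comm_ring_hom (even_part :: 'k::comm_ring_1 gext \<Rightarrow> 'k gext)"
proof
  show "even_part (1 :: 'k gext) = 1" by transfer (auto simp: gone_def fun_eq_iff)
  show "even_part (0 :: 'k gext) = 0" by transfer auto
qed (simp_all add: even_part_add even_part_mult)

lemma even_part_eq: "has_parity 0 (Rep_gext x) \<Longrightarrow> even_part x = x"
  and odd_part_eq: "has_parity 1 (Rep_gext x) \<Longrightarrow> odd_part x = x"
  and odd_part_eq_0: "has_parity 0 (Rep_gext x) \<Longrightarrow> odd_part x = 0"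
  and even_part_eq_0: "has_parity 1 (Rep_gext x) \<Longrightarrow> even_part x = 0"
  by (transfer, force simp: has_parity_def fun_eq_iff)+

lemma has_parity_even_part: "has_parity 0 (Rep_gext (even_part x))"
  using gsupp_Rep[of x] by (auto simp: has_parity_def even_part.rep_eq gsupp_def)

section \<open>Characteristic polynomials in coordinates\<close>

lemma Rep_prod_list_coeff:
  assumes "\<And>i k. i \<in> set xs \<Longrightarrow> has_parity 0 (F i k)"
    and "\<And>i k. i \<in> set xs \<Longrightarrow> Rep_gext (coeff (q i) k) = F i k"
  shows "Rep_gext (coeff (prod_list (map q xs)) k) = foldr (\<lambda>i acc. gpoly_mult (F i) acc) xs gpoly_one k"
  using assms
proof (induction xs arbitrary: k)
  case Nil
  then show ?case by (auto simp: gpoly_one_def one_gext.rep_eq zero_gext.rep_eq)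
next
  case (Cons i xs)
  have "Rep_gext (coeff (q i) m * coeff (prod_list (map q xs)) m')
      = gmul (F i m) (foldr (\<lambda>i acc. gpoly_mult (F i) acc) xs gpoly_one m')" for m m'
    using Cons by (subst Rep_gext_mult_even) auto
  then show ?case
    by (simp add: coeff_mult Rep_gext_sum gpoly_mult_def)
qed

text \<open>For even entries the ring product agrees with \<open>gmul\<close>, so the two Leibniz
  sums agree permutation by permutation.\<close>

lemma Rep_char_poly:
  fixes A :: "'k::comm_ring_1 gext mat"
  assumes A: "A \<in> carrier_mat n n"
    and even: "\<And>i j. i < n \<Longrightarrow> j < n \<Longrightarrow> has_parity 0 (D i j)"
    and D: "\<And>i j. i < n \<Longrightarrow> j < n \<Longrightarrow> Rep_gext (A $$ (i, j)) = D i j"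
  shows "Rep_gext (coeff (char_poly A) k) = charpoly_coeff n D k"
proof -
  define M where "M = char_poly_matrix A"
  have M: "M \<in> carrier_mat n n" using A by (simp add: M_def)
  define F where "F i j k = (if k = 1 \<and> i = j then gone else 0) - (if k = 0 then D i j else 0)" for i j k :: nat
  have MF: "Rep_gext (coeff (M $$ (i, j)) k) = F i j k" if "i < n" "j < n" for i j k
    using that A D[OF that] by (cases k)
      (auto simp: M_def char_poly_matrix_def F_def coeff_pCons one_gext.rep_eq zero_gext.rep_eq
        uminus_gext.rep_eq plus_gext.rep_eq split: nat.split)
  have evF: "has_parity 0 (F i j k)" if "i < n" "j < n" for i j k
    using even[OF that] by (auto simp: F_def has_parity_def gone_def)
  have sgn: "Rep_gext (coeff (signof p * q) k) = gscale (of_int (sign p)) (Rep_gext (coeff q k))"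
    for p :: "nat \<Rightarrow> nat" and q :: "'k gext poly"
    by (cases p rule: sign_cases) (auto simp: gscale_def uminus_gext.rep_eq)
  have factors: "Rep_gext (coeff (\<Prod>i = 0..<n. M $$ (i, p i)) k)
      = foldr (\<lambda>i acc. gpoly_mult (F i (p i)) acc) [0..<n] gpoly_one k" if "p permutes {..<n}" for p
  proof -
    have "p i < n" if "i < n" for i
      using permutes_in_image[OF \<open>p permutes {..<n}\<close>] that by auto
    then have "Rep_gext (coeff (prod_list (map (\<lambda>i. M $$ (i, p i)) [0..<n])) k)
        = foldr (\<lambda>i acc. gpoly_mult (F i (p i)) acc) [0..<n] gpoly_one k"
      by (intro Rep_prod_list_coeff) (auto intro: evF MF)
    then show ?thesis
      using prod.distinct_set_conv_list[of "[0..<n]" "\<lambda>i. M $$ (i, p i)"] by simp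
  qed
  have "Rep_gext (coeff (char_poly A) k) = (\<Sum>p | p permutes {..<n}.
      gscale (of_int (sign p)) (Rep_gext (coeff (\<Prod>i = 0..<n. M $$ (i, p i)) k)))"
    unfolding char_poly_def M_def[symmetric] det_def'[OF M]
    by (simp add: coeff_sum Rep_gext_sum sgn atLeast0LessThan)
  also have "\<dots> = charpoly_coeff n D k"
    unfolding charpoly_coeff_def gpoly_det_def F_def[symmetric]
    by (subst sum_fun_apply) (simp add: factors)
  finally show ?thesis .
qed

text \<open>The total \<open>t\<close> arises from \<open>t + 1\<close> pairs. With
  \<open>m = t + 1\<close> the double sum of the recursion gets the weights \<open>m\<close> found
  in the \<open>\<theta>\<close>-part of Newton's identities.\<close>

lemma sum_pairs_by_total:
  fixes F :: "nat \<Rightarrow> 'k::comm_ring_1 grass"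
  shows "(\<Sum>(r, s)\<in>{(r, s). r + s \<le> M}. F (r + s)) = (\<Sum>m\<in>{1..Suc M}. gscale (of_nat m) (F (m - 1)))"
proof -
  have c: "(\<Sum>r\<le>t. F t) = gscale (of_nat (Suc t)) (F t)" for t
    by (auto simp: fun_eq_iff sum_fun_apply gscale_def)
  have "(\<Sum>(r, s)\<in>{(r, s). r + s \<le> M}. F (r + s)) = (\<Sum>(t, r)\<in>(SIGMA t:{..M}. {..t}). F t)"
    by (rule sum.reindex_bij_witness[of _ "\<lambda>(t, r). (r, t - r)" "\<lambda>(r, s). (r + s, r)"]) auto
  also have "\<dots> = (\<Sum>t\<le>M. \<Sum>r\<le>t. F t)"
    by (subst sum.Sigma) auto
  also have "\<dots> = (\<Sum>m\<in>{1..Suc M}. gscale (of_nat m) (F (m - 1)))"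
    unfolding c by (rule sum.reindex_bij_witness[of _ "\<lambda>m. m - 1" Suc]) auto
  finally show ?thesis .
qed

section \<open>The deformation of the square of an odd matrix\<close>

text \<open>This is \<open>B\<^sup>2 + \<theta> B\<close>: an odd element \<open>b\<close> represents \<open>\<theta> b\<close>.\<close>

definition deformed_square :: "nat \<Rightarrow> 'k::comm_ring_1 gmat \<Rightarrow> 'k gext mat" where
  "deformed_square n B = mat n n (\<lambda>(i, j). Abs_gext (gmat_pow n B 2 i j) + Abs_gext (gmat_pow n B 1 i j))"

text \<open>The coefficients \<open>\<epsilon>\<^sub>k\<close> that will turn out to be
  \<open>\<delta>\<^sub>k\<close>.\<close>

definition odd_charpoly_coeff :: "nat \<Rightarrow> 'k::comm_ring_1 gmat \<Rightarrow> nat \<Rightarrow> 'k grass" where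
  "odd_charpoly_coeff n B k = Rep_gext (odd_part (coeff (char_poly (deformed_square n B)) k))"

context
  fixes n :: nat and B :: "'k::comm_ring_1 gmat"
  assumes B: "\<forall>i<n. \<forall>j<n. has_parity 1 (B i j)"
begin

lemma gsupp_pow: "i < n \<Longrightarrow> j < n \<Longrightarrow> gsupp (gmat_pow n B k i j)"
  by (rule has_parity_gsupp[OF gmat_pow_parity[OF B]])

lemma Rep_Abs_pow: "i < n \<Longrightarrow> j < n \<Longrightarrow> Rep_gext (Abs_gext (gmat_pow n B k i j)) = gmat_pow n B k i j"
  by (rule Rep_Abs_gext[OF gsupp_pow])

lemma parity_Abs_pow:
  assumes ij: "i < n" "j < n"
  shows "even k \<Longrightarrow> has_parity 0 (Rep_gext (Abs_gext (gmat_pow n B k i j)))"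
    and "odd k \<Longrightarrow> has_parity 1 (Rep_gext (Abs_gext (gmat_pow n B k i j)))"
  unfolding Rep_Abs_pow[OF ij]
  by (rule has_parity_cong[OF gmat_pow_parity[OF B ij, of k]]; simp)+

text \<open>An even exponent on one side keeps the product from being truncated.\<close>

lemma Abs_pow_mult:
  assumes ij: "i < n" "j < n" and ab: "even a \<or> even b"
  shows "(\<Sum>l<n. Abs_gext (gmat_pow n B a i l) * Abs_gext (gmat_pow n B b l j))
    = Abs_gext (gmat_pow n B (a + b) i j)"
proof -
  have "Rep_gext (Abs_gext (gmat_pow n B a i l) * Abs_gext (gmat_pow n B b l j))
      = gmul (gmat_pow n B a i l) (gmat_pow n B b l j)" if l: "l < n" for l
  proof -
    have "has_parity 0 (Rep_gext (Abs_gext (gmat_pow n B a i l)))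
        \<or> has_parity 0 (Rep_gext (Abs_gext (gmat_pow n B b l j)))"
      using ab parity_Abs_pow(1)[OF ij(1) l] parity_Abs_pow(1)[OF l ij(2)] by blast
    from Rep_gext_mult_even[OF this] show ?thesis
      unfolding Rep_Abs_pow[OF ij(1) l] Rep_Abs_pow[OF l ij(2)] .
  qed
  then have "Rep_gext (\<Sum>l<n. Abs_gext (gmat_pow n B a i l) * Abs_gext (gmat_pow n B b l j))
      = gmat_mult n (gmat_pow n B a) (gmat_pow n B b) i j"
    by (simp add: Rep_gext_sum gmat_mult_def)
  also have "\<dots> = Rep_gext (Abs_gext (gmat_pow n B (a + b) i j))"
    by (simp only: gmat_pow_add[OF B ij] Rep_Abs_pow[OF ij])
  finally show ?thesis by (simp only: Rep_gext_inject)
qed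

lemma deformed_square_carrier: "deformed_square n B \<in> carrier_mat n n"
  by (simp add: deformed_square_def)

text \<open>In \<open>(B^2 + \<theta> B) (B^(2k) + k \<theta> B^(2k-1))\<close> the product of the
  two \<open>\<theta>\<close>-terms vanishes, and the mixed terms add up to
  \<open>(k + 1) \<theta> B^(2k+1)\<close>.\<close>

lemma deformed_square_pow:
  assumes "i < n" "j < n"
  shows "(deformed_square n B ^\<^sub>m k) $$ (i, j)
    = Abs_gext (gmat_pow n B (2 * k) i j) + of_nat k * Abs_gext (gmat_pow n B (2 * k - 1) i j)"
  using assms
proof (induction k arbitrary: i j)
  case 0
  have "Abs_gext gone = (1 :: 'k gext)" "Abs_gext 0 = (0 :: 'k gext)"
    by (simp_all only: one_gext_def zero_gext_def)
  with 0 show ?case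
    using deformed_square_carrier by (auto simp: gmat_id_def)
next
  case (Suc k)
  let ?G = "\<lambda>m i j. Abs_gext (gmat_pow n B m i j)"
  \<comment> \<open>At \<open>k = 0\<close> the truncated exponent \<open>2 * k - 1\<close> is 0
    instead of odd; the factor \<open>of_nat k\<close> makes this case harmless, here and in
    \<open>zero\<close>.\<close>
  have odd: "of_nat k * (\<Sum>l<n. ?G 2 i l * ?G (2 * k - 1) l j) = of_nat k * ?G (2 * k + 1) i j"
    using Suc.prems Abs_pow_mult[of i j 2 "2 * k - 1"] by (cases k) auto
  have zero: "of_nat k * (\<Sum>l<n. ?G 1 i l * ?G (2 * k - 1) l j) = 0"
  proof (cases k)
    case (Suc k')
    then have "?G 1 i l * ?G (2 * k - 1) l j = 0" if "l < n" for l
      using that Suc.prems by (intro Rep_gext_mult_odd parity_Abs_pow(2)) auto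
    then show ?thesis by simp
  qed simp
  have "(deformed_square n B ^\<^sub>m Suc k) $$ (i, j) = (deformed_square n B * deformed_square n B ^\<^sub>m k) $$ (i, j)"
    by (simp only: mat_pow_Suc_left[OF deformed_square_carrier])
  also have "\<dots> = (\<Sum>l<n. deformed_square n B $$ (i, l) * (deformed_square n B ^\<^sub>m k) $$ (l, j))"
    using Suc.prems deformed_square_carrier by (auto simp: scalar_prod_def atLeast0LessThan)
  also have "\<dots> = (\<Sum>l<n. (?G 2 i l + ?G 1 i l) * (?G (2 * k) l j + of_nat k * ?G (2 * k - 1) l j))"
    using Suc.prems Suc.IH by (intro sum.cong refl) (simp add: deformed_square_def)
  also have "\<dots> = (\<Sum>l<n. ?G 2 i l * ?G (2 * k) l j) + (\<Sum>l<n. ?G 1 i l * ?G (2 * k) l j)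
      + of_nat k * (\<Sum>l<n. ?G 2 i l * ?G (2 * k - 1) l j) + of_nat k * (\<Sum>l<n. ?G 1 i l * ?G (2 * k - 1) l j)"
    unfolding sum_distrib_left sum.distrib[symmetric] by (intro sum.cong refl) (simp only: algebra_simps)
  also have "\<dots> = ?G (2 + 2 * k) i j + ?G (1 + 2 * k) i j + of_nat k * ?G (2 * k + 1) i j + 0"
    using Suc.prems unfolding odd zero by (simp only: Abs_pow_mult even_mult_iff even_numeral simp_thms)
  also have "\<dots> = ?G (2 * Suc k) i j + of_nat (Suc k) * ?G (2 * Suc k - 1) i j"
    by (simp add: algebra_simps)
  finally show ?case .
qed

lemma even_part_deformed_square_pow:
  assumes "i < n" "j < n"
  shows "even_part ((deformed_square n B ^\<^sub>m k) $$ (i, j)) = Abs_gext (gmat_pow n B (2 * k) i j)"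
proof -
  interpret E: comm_ring_hom "even_part :: 'k gext \<Rightarrow> 'k gext" by (rule comm_ring_hom_even_part)
  show ?thesis
    using assms unfolding deformed_square_pow[OF assms] even_part_add even_part_mult E.hom_of_nat
    by (cases k) (simp_all add: even_part_eq even_part_eq_0[OF parity_Abs_pow(2)] parity_Abs_pow del: gmat_pow.simps)
qed

lemma odd_part_deformed_square_pow:
  assumes "i < n" "j < n"
  shows "odd_part ((deformed_square n B ^\<^sub>m k) $$ (i, j)) = of_nat k * Abs_gext (gmat_pow n B (2 * k - 1) i j)"
  using assms unfolding deformed_square_pow[OF assms] odd_part_add odd_part_of_nat_mult
  by (cases k) (simp_all add: odd_part_eq[OF parity_Abs_pow(2)] odd_part_eq_0 parity_Abs_pow del: gmat_pow.simps)

text \<open>The ring homomorphism \<open>even_part\<close> commutes with the characteristic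
  polynomial and sends the deformed square to \<open>B^2\<close>.\<close>

lemma even_part_char_poly_deformed_square:
  "Rep_gext (even_part (coeff (char_poly (deformed_square n B)) k)) = charpoly_coeff n (gmat_pow n B 2) k"
proof -
  interpret E: comm_ring_hom "even_part :: 'k gext \<Rightarrow> 'k gext" by (rule comm_ring_hom_even_part)
  have "even_part (coeff (char_poly (deformed_square n B)) k) = coeff (char_poly (map_mat even_part (deformed_square n B))) k"
    by (simp add: E.char_poly_hom[OF deformed_square_carrier])
  also have "Rep_gext \<dots> = charpoly_coeff n (gmat_pow n B 2) k"
  proof (rule Rep_char_poly)
    fix i j assume ij: "i < n" "j < n"
    then show "has_parity 0 (gmat_pow n B 2 i j)"
      using parity_Abs_pow(1)[OF ij, of 2] Rep_Abs_pow[OF ij] by simp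
    have "map_mat even_part (deformed_square n B) $$ (i, j) = even_part ((deformed_square n B ^\<^sub>m 1) $$ (i, j))"
      using ij deformed_square_carrier by auto
    then show "Rep_gext (map_mat even_part (deformed_square n B) $$ (i, j)) = gmat_pow n B 2 i j"
      using even_part_deformed_square_pow[OF ij, of 1] Rep_Abs_pow[OF ij] by simp
  qed (simp add: deformed_square_carrier)
  finally show ?thesis .
qed

text \<open>The product rule read in E: each summand has an even factor, so both products are
  genuine Grassmann products.\<close>

lemma Rep_odd_part_mult:
  "Rep_gext (odd_part (coeff (char_poly (deformed_square n B)) k * x))
    = gmul (charpoly_coeff n (gmat_pow n B 2) k) (Rep_gext (odd_part x)) + gmul (odd_charpoly_coeff n B k) (Rep_gext (even_part x))"
  unfolding even_part_char_poly_deformed_square[symmetric] odd_charpoly_coeff_def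
  by (simp add: odd_part_mult plus_gext.rep_eq Rep_gext_mult_even has_parity_even_part)

lemma odd_charpoly_coeff_top: "odd_charpoly_coeff n B n = 0"
  using degree_monic_char_poly[OF deformed_square_carrier] by (simp add: odd_charpoly_coeff_def odd_part_1 zero_gext.rep_eq)

lemma cayley_hamilton_odd_part:
  assumes ij: "i < n" "j < n"
  shows "(\<Sum>k\<le>n. gscale (of_nat k) (gmul (charpoly_coeff n (gmat_pow n B 2) k) (gmat_pow n B (2 * k - 1) i j))
      + gmul (odd_charpoly_coeff n B k) (gmat_pow n B (2 * k) i j)) = 0"
proof -
  have "0 = Rep_gext (odd_part (\<Sum>k\<le>n. coeff (char_poly (deformed_square n B)) k * (deformed_square n B ^\<^sub>m k) $$ (i, j)))"
    by (simp only: cayley_hamilton[OF deformed_square_carrier ij] odd_part_0 zero_gext.rep_eq)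
  also have "\<dots> = (\<Sum>k\<le>n. gscale (of_nat k) (gmul (charpoly_coeff n (gmat_pow n B 2) k) (gmat_pow n B (2 * k - 1) i j))
      + gmul (odd_charpoly_coeff n B k) (gmat_pow n B (2 * k) i j))"
    by (simp only: odd_part_sum Rep_gext_sum Rep_odd_part_mult even_part_deformed_square_pow[OF ij]
        odd_part_deformed_square_pow[OF ij] Rep_gext_of_nat_mult gmul_gscale_right Rep_Abs_pow[OF ij])
  finally show ?thesis by simp
qed

text \<open>The trace of the \<open>m\<close>-th power of the deformed square has even part
  \<open>tr B^(2m)\<close> and odd part \<open>m tr B^(2m-1)\<close>. Up to division by
  \<open>n - k\<close> this is the recursion for \<open>\<delta>\<close>.\<close>

lemma newton_odd_part:
  assumes k: "k \<le> n"
  shows "gscale (of_nat (n - k)) (odd_charpoly_coeff n B k)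
    = - (\<Sum>m\<in>{1..n - k}. gscale (of_nat m) (gmul (charpoly_coeff n (gmat_pow n B 2) (k + m)) (gmat_trace n (gmat_pow n B (2 * m - 1))))
        + gmul (odd_charpoly_coeff n B (k + m)) (gmat_trace n (gmat_pow n B (2 * m))))"
proof -
  let ?P = "deformed_square n B"
  interpret E: comm_ring_hom "even_part :: 'k gext \<Rightarrow> 'k gext" by (rule comm_ring_hom_even_part)
  have e: "Rep_gext (even_part (\<Sum>i<n. (?P ^\<^sub>m m) $$ (i, i))) = gmat_trace n (gmat_pow n B (2 * m))" for m
    unfolding E.hom_sum gmat_trace_def Rep_gext_sum
    by (intro sum.cong refl) (simp add: even_part_deformed_square_pow Rep_Abs_pow)
  have o: "Rep_gext (odd_part (\<Sum>i<n. (?P ^\<^sub>m m) $$ (i, i))) = gscale (of_nat m) (gmat_trace n (gmat_pow n B (2 * m - 1)))" for m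
  proof -
    have "odd_part (\<Sum>i<n. (?P ^\<^sub>m m) $$ (i, i)) = of_nat m * (\<Sum>i<n. Abs_gext (gmat_pow n B (2 * m - 1) i i))"
      unfolding odd_part_sum sum_distrib_left by (intro sum.cong refl) (simp add: odd_part_deformed_square_pow)
    then show ?thesis
      by (simp add: Rep_gext_of_nat_mult Rep_gext_sum gmat_trace_def Rep_Abs_pow)
  qed
  have "gscale (of_nat (n - k)) (odd_charpoly_coeff n B k) = Rep_gext (odd_part (of_nat (n - k) * coeff (char_poly ?P) k))"
    by (simp add: odd_part_of_nat_mult Rep_gext_of_nat_mult odd_charpoly_coeff_def)
  also have "\<dots> = - (\<Sum>m\<in>{1..n - k}. Rep_gext (odd_part (coeff (char_poly ?P) (k + m) * (\<Sum>i<n. (?P ^\<^sub>m m) $$ (i, i)))))"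
    by (simp only: newton_identity[OF deformed_square_carrier k] odd_part_uminus odd_part_sum uminus_gext.rep_eq Rep_gext_sum)
  finally show ?thesis
    by (simp only: Rep_odd_part_mult e o gmul_gscale_right)
qed

end

section \<open>Identification of \<open>\<delta>\<close> and the final identity\<close>

text \<open>Descending induction on \<open>k\<close>: both sequences vanish at \<open>n\<close> and
  satisfy the same recursion, Newton's identity being divisible by \<open>n - k\<close> in
  characteristic zero.\<close>

lemma odd_charpoly_coeff_unique:
  fixes n :: nat and B :: "'k::field_char_0 gmat" and \<delta> :: "nat \<Rightarrow> 'k grass"
  defines "\<gamma> \<equiv> charpoly_coeff n (gmat_pow n B 2)"
  assumes B: "\<forall>i<n. \<forall>j<n. has_parity 1 (B i j)"
    and delta_n: "\<delta> n = 0"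
    and delta_rec: "\<forall>k<n. \<delta> k =
        (\<Sum>i\<in>{1..n - k}. gscale (- 1 / of_nat (n - k))
            (gmul (\<delta> (k + i)) (gmat_trace n (gmat_pow n B (2 * i)))))
      + (\<Sum>(r, s)\<in>{(r, s). r + s \<le> n - k - 1}. gscale (- 1 / of_nat (n - k))
            (gmul (\<gamma> (k + r + s + 1)) (gmat_trace n (gmat_pow n B (2 * r + 2 * s + 1)))))"
    and "k \<le> n"
  shows "\<delta> k = odd_charpoly_coeff n B k"
  using \<open>k \<le> n\<close>
proof (induction "n - k" arbitrary: k rule: less_induct)
  case less
  show ?case
  proof (cases "k = n")
    case True
    then show ?thesis by (simp add: delta_n odd_charpoly_coeff_top[OF B])
  next
    case False
    with less.prems have k: "k < n" by simp
    define c :: 'k where "c = - 1 / of_nat (n - k)"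
    let ?tr = "\<lambda>m. gmat_trace n (gmat_pow n B m)"
    have c: "c * of_nat (n - k) = -1" using k by (simp add: c_def)
    \<comment> \<open>The summand for \<open>(r, s)\<close> depends only on
      \<open>t = r + s\<close>.\<close>
    define F where "F t = gscale c (gmul (\<gamma> (k + t + 1)) (?tr (2 * t + 1)))" for t
    have "(\<Sum>(r, s)\<in>{(r, s). r + s \<le> n - k - 1}. gscale c (gmul (\<gamma> (k + r + s + 1)) (?tr (2 * r + 2 * s + 1))))
        = (\<Sum>(r, s)\<in>{(r, s). r + s \<le> n - k - 1}. F (r + s))"
      unfolding F_def by (simp only: add.assoc add_mult_distrib2)
    also have "\<dots> = (\<Sum>m\<in>{1..n - k}. gscale (of_nat m) (F (m - 1)))"
    proof -
      \<comment> \<open>\<open>k < n\<close> keeps the natural subtraction exact.\<close>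
      have "Suc (n - k - 1) = n - k" using k by simp
      then show ?thesis using sum_pairs_by_total[of F "n - k - 1"] by metis
    qed
    also have "\<dots> = (\<Sum>m\<in>{1..n - k}. gscale c (gscale (of_nat m) (gmul (\<gamma> (k + m)) (?tr (2 * m - 1)))))"
    proof (intro sum.cong refl)
      fix m assume "m \<in> {1..n - k}"
      then obtain m' where "m = Suc m'" by (cases m) auto
      then show "gscale (of_nat m) (F (m - 1)) = gscale c (gscale (of_nat m) (gmul (\<gamma> (k + m)) (?tr (2 * m - 1))))"
        by (simp add: F_def gscale_left_commute del: of_nat_Suc gmat_pow.simps)
    qed
    finally have snd: "(\<Sum>(r, s)\<in>{(r, s). r + s \<le> n - k - 1}. gscale c (gmul (\<gamma> (k + r + s + 1)) (?tr (2 * r + 2 * s + 1))))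
        = (\<Sum>m\<in>{1..n - k}. gscale c (gscale (of_nat m) (gmul (\<gamma> (k + m)) (?tr (2 * m - 1)))))" .
    have fst: "(\<Sum>i\<in>{1..n - k}. gscale c (gmul (\<delta> (k + i)) (?tr (2 * i))))
        = (\<Sum>i\<in>{1..n - k}. gscale c (gmul (odd_charpoly_coeff n B (k + i)) (?tr (2 * i))))"
      using less.hyps by (intro sum.cong refl) (use k in auto)
    have add: "gscale c f + gscale c g = gscale c (g + f)" for f g :: "'k grass"
      by (auto simp: gscale_def algebra_simps fun_eq_iff)
    have "\<delta> k = (\<Sum>i\<in>{1..n - k}. gscale c (gmul (\<delta> (k + i)) (?tr (2 * i))))
        + (\<Sum>(r, s)\<in>{(r, s). r + s \<le> n - k - 1}. gscale c (gmul (\<gamma> (k + r + s + 1)) (?tr (2 * r + 2 * s + 1))))"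
      unfolding c_def by (rule delta_rec[rule_format, OF k])
    also have "\<dots> = gscale c (\<Sum>m\<in>{1..n - k}. gscale (of_nat m) (gmul (\<gamma> (k + m)) (?tr (2 * m - 1)))
        + gmul (odd_charpoly_coeff n B (k + m)) (?tr (2 * m)))"
      unfolding fst snd sum.distrib[symmetric] add gscale_sum ..
    also have "\<dots> = gscale c (- gscale (of_nat (n - k)) (odd_charpoly_coeff n B k))"
      unfolding newton_odd_part[OF B less_imp_le[OF k]] \<gamma>_def minus_minus ..
    also have "\<dots> = odd_charpoly_coeff n B k"
    proof
      fix S
      have "gscale c (- gscale (of_nat (n - k)) (odd_charpoly_coeff n B k)) S = - (c * of_nat (n - k)) * odd_charpoly_coeff n B k S"
        by (simp add: gscale_def)
      then show "gscale c (- gscale (of_nat (n - k)) (odd_charpoly_coeff n B k)) S = odd_charpoly_coeff n B k S"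
        by (simp add: c)
    qed
    finally show ?thesis .
  qed
qed

theorem theorem2p3:
  fixes n :: nat
    and B :: "'k::field_char_0 gmat"
    and \<delta> :: "nat \<Rightarrow> 'k grass"
  defines "\<gamma> \<equiv> charpoly_coeff n (gmat_pow n B 2)"
  assumes n_pos: "1 \<le> n"
    and B_odd: "\<forall>i<n. \<forall>j<n. grass_odd (B i j)"
    and delta_n: "\<delta> n = 0"
    and delta_rec: "\<forall>k<n. \<delta> k =
        (\<Sum>i\<in>{1..n - k}. gscale (- 1 / of_nat (n - k))
            (gmul (\<delta> (k + i)) (gmat_trace n (gmat_pow n B (2 * i)))))
      + (\<Sum>(r, s)\<in>{(r, s). r + s \<le> n - k - 1}. gscale (- 1 / of_nat (n - k))
            (gmul (\<gamma> (k + r + s + 1)) (gmat_trace n (gmat_pow n B (2 * r + 2 * s + 1)))))"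
  shows "\<forall>i<n. \<forall>j<n.
      gmul (\<delta> 0) (gmat_id i j)
      + (\<Sum>k\<in>{1..n}. gscale (of_nat k) (gmul (\<gamma> k) (gmat_pow n B (2 * k - 1) i j))
                     + gmul (\<delta> k) (gmat_pow n B (2 * k) i j)) = 0"
proof (intro allI impI)
  fix i j assume ij: "i < n" "j < n"
  have B: "\<forall>i<n. \<forall>j<n. has_parity 1 (B i j)"
    using B_odd by (auto simp: grass_odd_def grass_elem_def has_parity_def)
  have \<delta>: "\<delta> k = odd_charpoly_coeff n B k" if "k \<le> n" for k
    by (rule odd_charpoly_coeff_unique[OF B delta_n delta_rec[unfolded \<gamma>_def] that])
  let ?t = "\<lambda>k. gscale (of_nat k) (gmul (\<gamma> k) (gmat_pow n B (2 * k - 1) i j))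
      + gmul (\<delta> k) (gmat_pow n B (2 * k) i j)"
  \<comment> \<open>The term \<open>k = 0\<close> is \<open>\<delta> 0\<close> times the identity
    matrix: its \<open>\<gamma>\<close>-summand has weight 0 and \<open>2 * k\<close> is 0.\<close>
  have "(\<Sum>k\<le>n. ?t k) = 0"
    using cayley_hamilton_odd_part[OF B ij] by (simp add: \<delta> \<gamma>_def)
  moreover have "{..n} = insert 0 {1..n}" by auto
  moreover have "gscale 0 f = 0" for f :: "'k grass" by (auto simp: gscale_def)
  ultimately show "gmul (\<delta> 0) (gmat_id i j) + (\<Sum>k\<in>{1..n}. ?t k) = 0"
    by simp
qed

end
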